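(* Let $d \ge 1$, let $u_0, u_p \in \mathbb{R}^d$ with $u_0 \neq u_p$, let $\lambda \ge 0$, and put $\bar{u} = \tfrac{1}{2}(u_0 + u_p)$. Consider the function of $(D_0, D_p) \in \mathbb{R}^d \times \mathbb{R}^d$ given by $$J(D_0, D_p) = \tfrac{1}{2}\bigl(\lVert D_0 - u_0\rVert^2 + \lVert D_p - u_p\rVert^2\bigr) + \lambda \lVert D_0 - D_p\rVert^2 .$$ Then the minimizer $(D_0^\ast, D_p^\ast)$ of $J$ over $\mathbb{R}^d \times \mathbb{R}^d$ satisfies $$\tfrac{1}{2}(D_0^\ast + D_p^\ast) = \bar{u}, \qquad D_0^\ast - D_p^\ast = \frac{u_0 - u_p}{1 + 4\lambda},$$ $$D_0^\ast - u_0 = -\frac{2\lambda}{1+4\lambda}\,(u_0 - u_p), \qquad D_p^\ast - u_p = +\frac{2\lambda}{1+4\lambda}\,(u_0 - u_p).$$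
   Context: $\lVert\cdot\rVert$ is the Euclidean norm on $\mathbb{R}^d$. $D_0$ and $D_p$ are the predictions of a model on two branches (a nominal view $0$ and a perturbed view $p$), $u_0$ and $u_p$ are the respective (different) targets of the two branches, and $\lambda$ is the weight of the penalty on disagreement between the two predictions. "Minimizer" refers to the pointwise minimizer, i.e. $D_0$ and $D_p$ are treated as free vectors. *)

theory Defs
  imports "HOL-Analysis.Analysis"
begin

definition two_branch_loss ::
  "real \<Rightarrow> real ^ 'd \<Rightarrow> real ^ 'd \<Rightarrow> (real ^ 'd) \<times> (real ^ 'd) \<Rightarrow> real" where
  "two_branch_loss l u\<^sub>0 u\<^sub>p = (\<lambda>(D\<^sub>0, D\<^sub>p).
     (1 / 2) * ((norm (D\<^sub>0 - u\<^sub>0))\<^sup>2 + (norm (D\<^sub>p - u\<^sub>p))\<^sup>2) + l * (norm (D\<^sub>0 - D\<^sub>p))\<^sup>2)"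

end

theory Submission
  imports Defs
begin

text \<open>The loss is a quadratic function of the pair; completing the square around its critical
  point shows that the excess over the value there is the positive definite form
  \<open>(\<parallel>a\<parallel>\<^sup>2 + \<parallel>b\<parallel>\<^sup>2) / 2 + l \<parallel>a - b\<parallel>\<^sup>2\<close> of the displacement \<open>(a, b)\<close>,
  so the critical point is the only minimizer.\<close>

text \<open>Solution of the stationarity equations: their sum keeps the midpoint of the targets, and
  their difference shrinks the gap by the factor \<open>1 + 4 * l\<close>.\<close>

definition two_branch_minimizer ::
  "real \<Rightarrow> real ^ 'd \<Rightarrow> real ^ 'd \<Rightarrow> (real ^ 'd) \<times> (real ^ 'd)" where
  "two_branch_minimizer l u\<^sub>0 u\<^sub>p =
     (u\<^sub>0 - (2 * l / (1 + 4 * l)) *\<^sub>R (u\<^sub>0 - u\<^sub>p), u\<^sub>p + (2 * l / (1 + 4 * l)) *\<^sub>R (u\<^sub>0 - u\<^sub>p))"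

lemma norm_add_scaleR_squared:
  fixes x y :: "'a::real_inner"
  shows "(norm (x + t *\<^sub>R y))\<^sup>2 = (norm x)\<^sup>2 + 2 * t * (x \<bullet> y) + t\<^sup>2 * (norm y)\<^sup>2"
  unfolding power2_norm_eq_inner
  by (simp add: inner_add_left inner_add_right inner_commute[of y x] power2_eq_square distrib_left)

lemma two_branch_loss_completed_square:
  assumes "l \<ge> 0"
  shows "two_branch_loss l u\<^sub>0 u\<^sub>p (two_branch_minimizer l u\<^sub>0 u\<^sub>p + (a, b)) =
    two_branch_loss l u\<^sub>0 u\<^sub>p (two_branch_minimizer l u\<^sub>0 u\<^sub>p) +
    ((1 / 2) * ((norm a)\<^sup>2 + (norm b)\<^sup>2) + l * (norm (a - b))\<^sup>2)"
proof -
  define c where "c = 2 * l / (1 + 4 * l)"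
  define w where "w = u\<^sub>0 - u\<^sub>p"
  have min: "two_branch_minimizer l u\<^sub>0 u\<^sub>p = (u\<^sub>0 - c *\<^sub>R w, u\<^sub>p + c *\<^sub>R w)"
    by (simp add: two_branch_minimizer_def c_def w_def)
  \<comment> \<open>This is stationarity: the pull of the penalty balances the pull towards the
    target. Nonnegativity of \<open>l\<close> keeps the denominator \<open>1 + 4 * l\<close>
    nonzero.\<close>
  have crit: "2 * l * (1 - 2 * c) = c"
    using assms by (simp add: c_def divide_simps)
  \<comment> \<open>Every residual becomes a displacement plus a multiple of the single vector
    \<open>w\<close>, the shape that \<open>norm_add_scaleR_squared\<close> expands; hence also the
    form \<open>(- c) *\<^sub>R w\<close>.\<close>
  have loss: "two_branch_loss l u\<^sub>0 u\<^sub>p (u\<^sub>0 - c *\<^sub>R w + x, u\<^sub>p + c *\<^sub>R w + y) =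
    (1 / 2) * ((norm (x + (- c) *\<^sub>R w))\<^sup>2 + (norm (y + c *\<^sub>R w))\<^sup>2) +
    l * (norm (x - y + (1 - 2 * c) *\<^sub>R w))\<^sup>2" for x y
  proof -
    have "u\<^sub>0 - c *\<^sub>R w + x - (u\<^sub>p + c *\<^sub>R w + y) = x - y + (1 - 2 * c) *\<^sub>R w"
      by (simp add: w_def algebra_simps flip: scaleR_2)
    moreover have "u\<^sub>0 - c *\<^sub>R w + x - u\<^sub>0 = x + (- c) *\<^sub>R w"
      and "u\<^sub>p + c *\<^sub>R w + y - u\<^sub>p = y + c *\<^sub>R w"
      by simp_all
    ultimately show ?thesis
      by (simp only: two_branch_loss_def prod.case)
  qed
  \<comment> \<open>The added zeros let \<open>loss\<close> rewrite both values. The terms in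
    \<open>(norm w)\<^sup>2\<close> cancel, and the cross terms combine into one multiple of
    \<open>(a - b) \<bullet> w\<close>, which \<open>crit\<close> annihilates.\<close>
  have "two_branch_loss l u\<^sub>0 u\<^sub>p (u\<^sub>0 - c *\<^sub>R w + a, u\<^sub>p + c *\<^sub>R w + b) -
    two_branch_loss l u\<^sub>0 u\<^sub>p (u\<^sub>0 - c *\<^sub>R w + 0, u\<^sub>p + c *\<^sub>R w + 0) =
    (1 / 2) * ((norm a)\<^sup>2 + (norm b)\<^sup>2) + l * (norm (a - b))\<^sup>2 +
    (2 * l * (1 - 2 * c) - c) * ((a - b) \<bullet> w)"
    unfolding loss norm_add_scaleR_squared by (simp add: inner_diff_left field_simps)
  then show ?thesis
    by (simp add: min crit)
qed

lemma two_branch_loss_minimizer_less: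
  assumes "l \<ge> 0" and "D \<noteq> two_branch_minimizer l u\<^sub>0 u\<^sub>p"
  shows "two_branch_loss l u\<^sub>0 u\<^sub>p (two_branch_minimizer l u\<^sub>0 u\<^sub>p) < two_branch_loss l u\<^sub>0 u\<^sub>p D"
proof -
  obtain a b where ab: "D - two_branch_minimizer l u\<^sub>0 u\<^sub>p = (a, b)"
    by (cases "D - two_branch_minimizer l u\<^sub>0 u\<^sub>p")
  then have D: "D = two_branch_minimizer l u\<^sub>0 u\<^sub>p + (a, b)"
    by (simp add: algebra_simps flip: ab)
  with assms(2) have "a \<noteq> 0 \<or> b \<noteq> 0"
    by (auto simp flip: zero_prod_def)
  \<comment> \<open>Strictness comes from the two fitting terms, so it persists at
    \<open>l = 0\<close>.\<close>
  then have "(norm a)\<^sup>2 + (norm b)\<^sup>2 > 0"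
    by (auto intro: add_pos_nonneg add_nonneg_pos)
  moreover have "l * (norm (a - b))\<^sup>2 \<ge> 0"
    using assms(1) by simp
  ultimately show ?thesis
    unfolding D two_branch_loss_completed_square[OF assms(1)]
    by (simp add: add_pos_nonneg)
qed

text \<open>Strict inequality at every other point yields both directions, hence existence and
  uniqueness together.\<close>

lemma is_arg_min_two_branch_loss_iff:
  assumes "l \<ge> 0"
  shows "is_arg_min (two_branch_loss l u\<^sub>0 u\<^sub>p) (\<lambda>D. D \<in> UNIV) D \<longleftrightarrow>
    D = two_branch_minimizer l u\<^sub>0 u\<^sub>p"
  using two_branch_loss_minimizer_less[OF assms] unfolding is_arg_min_def
  by (metis UNIV_I order_less_asym order_less_irrefl)

theorem proposition1:
  fixes u\<^sub>0 u\<^sub>p ubar :: "real ^ 'd" and l :: real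
  assumes "u\<^sub>0 \<noteq> u\<^sub>p" and "l \<ge> 0"
    and "ubar = (1 / 2) *\<^sub>R (u\<^sub>0 + u\<^sub>p)"
  shows "(\<exists>!D. is_arg_min (two_branch_loss l u\<^sub>0 u\<^sub>p) (\<lambda>D. D \<in> UNIV) D) \<and>
    (\<forall>D\<^sub>0 D\<^sub>p. is_arg_min (two_branch_loss l u\<^sub>0 u\<^sub>p) (\<lambda>D. D \<in> UNIV) (D\<^sub>0, D\<^sub>p) \<longrightarrow>
       (1 / 2) *\<^sub>R (D\<^sub>0 + D\<^sub>p) = ubar \<and>
       D\<^sub>0 - D\<^sub>p = (u\<^sub>0 - u\<^sub>p) /\<^sub>R (1 + 4 * l) \<and>
       D\<^sub>0 - u\<^sub>0 = - ((2 * l / (1 + 4 * l)) *\<^sub>R (u\<^sub>0 - u\<^sub>p)) \<and>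
       D\<^sub>p - u\<^sub>p = (2 * l / (1 + 4 * l)) *\<^sub>R (u\<^sub>0 - u\<^sub>p))"
proof -
  have "1 - 2 * (2 * l / (1 + 4 * l)) = inverse (1 + 4 * l)"
    using assms(2) by (simp add: field_simps)
  \<comment> \<open>A general \<open>c\<close> keeps the fraction out of the vector algebra; it is
    instantiated only at the end.\<close>
  moreover have "u\<^sub>0 - c *\<^sub>R w - (u\<^sub>p + c *\<^sub>R w) = (1 - 2 * c) *\<^sub>R w" if "w = u\<^sub>0 - u\<^sub>p" for c w
    by (simp add: that algebra_simps flip: scaleR_2)
  ultimately have "u\<^sub>0 - (2 * l / (1 + 4 * l)) *\<^sub>R (u\<^sub>0 - u\<^sub>p) - (u\<^sub>p + (2 * l / (1 + 4 * l)) *\<^sub>R (u\<^sub>0 - u\<^sub>p)) =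
    (u\<^sub>0 - u\<^sub>p) /\<^sub>R (1 + 4 * l)"
    by metis
  then show ?thesis
    unfolding is_arg_min_two_branch_loss_iff[OF assms(2)]
    by (auto simp: two_branch_minimizer_def assms(3))
qed

end
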